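(* Let $D$ be an acyclic digraph with a single vertex $s$ of in-degree zero, let $D^*$ be the digraph obtained from $D$ by applying Reduction Rules A and B as long as possible, let $n^*=|V(D^* )|$, and let $k$ be a positive integer. If $D^*$ has no out-branching with at least $k$ leaves, then $n^*<6.6(k+2)$.
   Context: An out-tree of a digraph is a subgraph that is an oriented tree with exactly one vertex of in-degree zero (its root); its leaves are the vertices of out-degree zero in it; an out-branching is a spanning out-tree. $d^+(v)$, $d^-(v)$, $N^+(v)$, $N^-(v)$ denote out-degree, in-degree, out-neighbourhood and in-neighbourhood in the current digraph. Reduction Rule A: if the digraph has an arc $xy$ with $d^+(x)=d^-(y)=1$, contract the arc $xy$. Reduction Rule B: if the digraph has an arc $xy$ with $d^+(x)\ge 2$, $d^-(y)=1$ and $x\ne s$, delete $x$ and add the arc $uv$ for each $u\in N^-(x)$ and $v\in N^+(x)$. *)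

theory Defs
  imports Complex_Main "Graph_Theory.Digraph_Component"
begin

(* The library predicate tree only excludes directed cycles, so it also holds for
   orientations of graphs that are not trees. An oriented tree is an orientation (no loops, no
   pair of opposite arcs) of an undirected tree: the underlying graph mk_symmetric T is connected
   and has no undirected cycle. As u, v, u counts as a cycle of mk_symmetric T, only
   cycles of length at least 3 correspond to undirected ones. *)
definition oriented_tree :: "'a pair_pre_digraph \<Rightarrow> bool" where
  "oriented_tree T \<longleftrightarrow>
     pair_wf_digraph T \<and> asym (parcs T) \<and> Digraph_Component.connected (with_proj T) \<and>
     \<not> (\<exists>p. pre_digraph.cycle (with_proj (mk_symmetric (with_proj T))) p \<and> 3 \<le> length p)"

definition out_tree :: "'a pair_pre_digraph \<Rightarrow> 'a pair_pre_digraph \<Rightarrow> bool" where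
  "out_tree T G \<longleftrightarrow>
     subgraph (with_proj T) (with_proj G) \<and> oriented_tree T \<and>
     (\<exists>!r. r \<in> pverts T \<and> in_degree (with_proj T) r = 0)"

definition leaves :: "'a pair_pre_digraph \<Rightarrow> 'a set" where
  "leaves T = {v \<in> pverts T. out_degree (with_proj T) v = 0}"

definition out_branching :: "'a pair_pre_digraph \<Rightarrow> 'a pair_pre_digraph \<Rightarrow> bool" where
  "out_branching T G \<longleftrightarrow> out_tree T G \<and> spanning (with_proj T) (with_proj G)"

definition out_nbrs :: "'a pair_pre_digraph \<Rightarrow> 'a \<Rightarrow> 'a set" where
  "out_nbrs G x = {v. (x, v) \<in> parcs G}"

definition in_nbrs :: "'a pair_pre_digraph \<Rightarrow> 'a \<Rightarrow> 'a set" where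
  "in_nbrs G x = {u. (u, x) \<in> parcs G}"

(* The vertex resulting from identifying x and y keeps the name x. In particular, if x is the
   source s of an acyclic digraph, the merged vertex is again called s; y is never the source. *)
definition contract_arc :: "'a pair_pre_digraph \<Rightarrow> 'a \<Rightarrow> 'a \<Rightarrow> 'a pair_pre_digraph" where
  "contract_arc G x y =
     (let f = (\<lambda>v. if v = y then x else v)
      in \<lparr> pverts = pverts G - {y},
           parcs = {(f u, f v) | u v. (u, v) \<in> parcs G \<and> f u \<noteq> f v} \<rparr>)"

definition bypass_vertex :: "'a pair_pre_digraph \<Rightarrow> 'a \<Rightarrow> 'a pair_pre_digraph" where
  "bypass_vertex G x =
     \<lparr> pverts = pverts G - {x},
       parcs = {(u, v) \<in> parcs G. u \<noteq> x \<and> v \<noteq> x} \<union> in_nbrs G x \<times> out_nbrs G x \<rparr>"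

inductive reduction_step :: "'a \<Rightarrow> 'a pair_pre_digraph \<Rightarrow> 'a pair_pre_digraph \<Rightarrow> bool"
  for s :: 'a where
  rule_A: "\<lbrakk>(x, y) \<in> parcs G; out_degree (with_proj G) x = 1; in_degree (with_proj G) y = 1\<rbrakk>
    \<Longrightarrow> reduction_step s G (contract_arc G x y)"
| rule_B: "\<lbrakk>(x, y) \<in> parcs G; out_degree (with_proj G) x \<ge> 2; in_degree (with_proj G) y = 1; x \<noteq> s\<rbrakk>
    \<Longrightarrow> reduction_step s G (bypass_vertex G x)"

definition fully_reduces_to :: "'a \<Rightarrow> 'a pair_pre_digraph \<Rightarrow> 'a pair_pre_digraph \<Rightarrow> bool" where
  "fully_reduces_to s D D' \<longleftrightarrow>
     (reduction_step s)\<^sup>*\<^sup>* D D' \<and> \<not> (\<exists>H. reduction_step s D' H)"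

end

theory Submission
  imports Defs
begin

text \<open>
  Acyclicity and the uniqueness of the source \<open>s\<close> survive both rules. Once neither rule applies,
  every vertex that is not an out-neighbour of \<open>s\<close> has at least two in-neighbours. In an acyclic
  digraph with a single source, any choice of one in-neighbour for each vertex other than \<open>s\<close> is
  an out-branching. So an out-branching with leaf set containing \<open>I\<close> exists as soon as \<open>I\<close> avoids
  \<open>s\<close> and contains no in-neighbourhood of a vertex outside \<open>N\<^sup>+[s]\<close>. These in-neighbourhoods
  form a hypergraph on the \<open>n* - 1\<close> vertices other than \<open>s\<close> with at most \<open>n* - 1\<close> edges, all of
  size at least two, and a greedy argument yields an independent set of size at least
  \<open>(n* - 1) / 3\<close>. Hence even \<open>n* \<le> 3 * k - 2\<close>.
\<close>

section \<open>Independent sets in hypergraphs\<close>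

text \<open>Greedy induction whose weights balance in each case. A vertex in two or more edges is
  dropped, lowering \<open>2 * card W\<close> by 2 and \<open>card J\<close> by at least 2. Without
  edges, \<open>W\<close> itself works. Otherwise some edge contributes one vertex to
  \<open>I\<close> and loses another: 4 on the left against 3 + 1 on the right. Indexing by
  \<open>J\<close> allows repeated edges.\<close>

lemma independent_set_card:
  assumes "finite W" "finite J"
    and "\<And>j. j \<in> J \<Longrightarrow> E j \<subseteq> W" "\<And>j. j \<in> J \<Longrightarrow> 2 \<le> card (E j)"
  shows "\<exists>I \<subseteq> W. (\<forall>j \<in> J. \<not> E j \<subseteq> I) \<and> 2 * card W \<le> 3 * card I + card J"
  using assms
proof (induction "card W" arbitrary: W J rule: less_induct)
  case less
  note fin = less.prems(1,2) and sub = less.prems(3) and two = less.prems(4)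
  consider (dense) v where "v \<in> W" "2 \<le> card {j \<in> J. v \<in> E j}"
    | (empty) "J = {}"
    | (matching) j where "j \<in> J" "\<And>v. v \<in> W \<Longrightarrow> card {j \<in> J. v \<in> E j} \<le> 1"
    by (metis all_not_in_conv not_less_eq_eq numeral_2_eq_2 One_nat_def)
  then show ?case
  proof cases
    case dense
    let ?J = "{j \<in> J. v \<notin> E j}"
    have "card J = card ?J + card {j \<in> J. v \<in> E j}"
      using fin by (subst card_Un_disjoint[symmetric]) (auto intro!: arg_cong[where f = card])
    with dense have cJ: "card ?J + 2 \<le> card J" by simp
    have cW: "card W = Suc (card (W - {v}))"
      using fin dense by (metis card.remove)
    obtain I where "I \<subseteq> W - {v}" "\<forall>j \<in> ?J. \<not> E j \<subseteq> I"
      "2 * card (W - {v}) \<le> 3 * card I + card ?J"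
      using less.hyps[of "W - {v}" ?J] cW fin sub two by auto
    then show ?thesis using cJ cW by (intro exI[of _ I]) auto
  next
    case empty
    then show ?thesis by (intro exI[of _ W]) auto
  next
    case matching
    obtain v w where vw: "v \<in> E j" "w \<in> E j" "v \<noteq> w"
      using obtain_subset_with_card_n[OF two[OF matching(1)]] by (metis card_2_iff' subsetD)
    then have vwW: "v \<in> W" "w \<in> W" using sub[OF matching(1)] by auto
    \<comment> \<open>No vertex lies in two edges, so the remaining edges are disjoint from
      \<open>E j\<close> and survive the removal of \<open>v\<close> and \<open>w\<close>
      intact.\<close>
    have uniq: "i = j" if "i \<in> J" "u \<in> E i" "u \<in> E j" for i u
    proof -
      have "u \<in> W" using that sub by auto
      from matching(2)[OF this] have "\<forall>a \<in> {j \<in> J. u \<in> E j}. \<forall>b \<in> {j \<in> J. u \<in> E j}. a = b"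
        using fin by (auto simp: card_le_Suc0_iff_eq)
      then show ?thesis using that matching(1) by auto
    qed
    have cW: "card W = Suc (Suc (card (W - {v, w})))"
      using fin vw vwW by (metis Diff_insert2 card.remove finite_Diff insert_Diff insert_iff)
    have cJ: "card J = Suc (card (J - {j}))"
      using fin matching(1) by (metis card.remove)
    have "E i \<subseteq> W - {v, w}" if "i \<in> J - {j}" for i
      using that sub[of i] uniq[of i v] uniq[of i w] vw by auto
    then obtain I where I: "I \<subseteq> W - {v, w}" "\<forall>i \<in> J - {j}. \<not> E i \<subseteq> I"
      "2 * card (W - {v, w}) \<le> 3 * card I + card (J - {j})"
      using less.hyps[of "W - {v, w}" "J - {j}"] cW fin two by auto
    \<comment> \<open>The edge \<open>E j\<close> is hit by the excluded vertex \<open>w\<close>;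
      every other edge misses \<open>v\<close>, so adding \<open>v\<close> does no harm.\<close>
    have "\<not> E i \<subseteq> insert v I" if "i \<in> J" for i
    proof (cases "i = j")
      case True
      then show ?thesis using vw I(1) by auto
    next
      case False
      then have "v \<notin> E i" using uniq[of i v] that vw by auto
      then show ?thesis using I(2) that False by auto
    qed
    moreover have "card (insert v I) = Suc (card I)"
      using I(1) fin by (subst card_insert_disjoint) (auto intro: finite_subset)
    ultimately show ?thesis
      using I cW cJ vwW by (intro exI[of _ "insert v I"]) auto
  qed
qed

section \<open>Acyclic digraphs with a single source\<close>

lemma in_degree_eq_card_in_nbrs: "in_degree (with_proj G) v = card (in_nbrs G v)"
proof -
  have "in_arcs (with_proj G) v = (\<lambda>u. (u, v)) ` in_nbrs G v"
    by (auto simp: in_nbrs_def)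
  then show ?thesis
    by (simp add: in_degree_def card_image inj_on_def)
qed

lemma out_degree_eq_card_out_nbrs: "out_degree (with_proj G) v = card (out_nbrs G v)"
proof -
  have "out_arcs (with_proj G) v = (\<lambda>u. (v, u)) ` out_nbrs G v"
    by (auto simp: out_nbrs_def)
  then show ?thesis
    by (simp add: out_degree_def card_image inj_on_def)
qed

text \<open>The invariant of the reduction. Sources are described by arcs instead of in-degrees,
  which makes them easy to compare between two digraphs.\<close>

locale single_source_dag = pair_fin_digraph G for G :: "'a pair_pre_digraph" +
  fixes s :: 'a
  assumes acyclic_arcs: "acyclic (parcs G)"
    and source_in_verts: "s \<in> pverts G"
    and no_arc_into_source: "(u, s) \<notin> parcs G"
    and ex_arc_into: "v \<in> pverts G \<Longrightarrow> v \<noteq> s \<Longrightarrow> \<exists>u. (u, v) \<in> parcs G"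
begin

lemma finite_in_nbrs: "finite (in_nbrs G v)"
  by (rule finite_subset[OF _ pair_finite_verts]) (auto simp: in_nbrs_def wellformed')

lemma no_loop: "(v, v) \<notin> parcs G"
  using acyclic_arcs by (auto simp: acyclic_def)

lemma no_opposite_arc: "(u, v) \<in> parcs G \<Longrightarrow> (v, u) \<notin> parcs G"
  using acyclic_arcs by (meson acyclic_def r_into_trancl trancl_trans)

section \<open>Invariance under the reduction rules\<close>

text \<open>Common criterion for both rules: if each new arc comes from a directed path of
  \<open>G\<close>, a cycle or an arc into \<open>s\<close> would already give a cycle or an arc
  into \<open>s\<close> in \<open>G\<close>.\<close>

lemma single_source_dag_replace:
  assumes "pverts H \<subseteq> pverts G" "parcs H \<subseteq> pverts H \<times> pverts H"
    and "parcs H \<subseteq> (parcs G)\<^sup>+" "s \<in> pverts H"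
    and "\<And>v. v \<in> pverts H \<Longrightarrow> v \<noteq> s \<Longrightarrow> \<exists>u. (u, v) \<in> parcs H"
  shows "single_source_dag H s"
proof
  show "finite (pverts H)" using assms(1) pair_finite_verts by (rule finite_subset)
  then show "finite (parcs H)" using assms(2) by (meson finite_SigmaI finite_subset)
  have "acyclic ((parcs G)\<^sup>+)"
    using acyclic_arcs by (simp add: acyclic_def trancl_id[OF trans_trancl])
  then show "acyclic (parcs H)" using assms(3) by (rule acyclic_subset)
  show "(u, s) \<notin> parcs H" for u
    using assms(3) no_arc_into_source by (blast dest: tranclD2)
qed (use assms in auto)

lemma single_source_dag_contract_arc:
  assumes xy: "(x, y) \<in> parcs G" and y: "in_nbrs G y = {x}"
  shows "single_source_dag (contract_arc G x y) s"
proof (rule single_source_dag_replace)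
  let ?H = "contract_arc G x y"
  have yx: "(y, x) \<notin> parcs G" "x \<noteq> y"
    using xy no_loop no_opposite_arc by blast+
  have inn: "u = x" if "(u, y) \<in> parcs G" for u using y that by (auto simp: in_nbrs_def)
  show "pverts ?H \<subseteq> pverts G" "parcs ?H \<subseteq> pverts ?H \<times> pverts ?H"
    using yx by (auto simp: contract_arc_def wellformed' in_arcsD1[OF xy])
  show "parcs ?H \<subseteq> (parcs G)\<^sup>+"
  proof clarify
    fix a b assume "(a, b) \<in> parcs ?H"
    then obtain u v where uv: "(u, v) \<in> parcs G" "a \<noteq> b"
      "a = (if u = y then x else u)" "b = (if v = y then x else v)"
      by (auto simp: contract_arc_def Let_def)
    show "(a, b) \<in> (parcs G)\<^sup>+"
    proof (cases "u = y")
      case True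
      then have "a = x" "(y, b) \<in> parcs G" using uv no_loop by (auto split: if_splits)
      then show ?thesis using xy by (meson r_into_trancl trancl_trans)
    next
      case False
      \<comment> \<open>If \<open>v = y\<close>, then \<open>u = x\<close> and the arc would
        collapse to a loop; so this arc is unchanged.\<close>
      then have "(a, b) \<in> parcs G" using uv inn by (auto split: if_splits)
      then show ?thesis ..
    qed
  qed
  show "s \<in> pverts ?H"
    using xy no_arc_into_source source_in_verts by (auto simp: contract_arc_def)
  show "\<exists>u. (u, v) \<in> parcs ?H" if "v \<in> pverts ?H" "v \<noteq> s" for v
  proof -
    have v: "v \<in> pverts G" "v \<noteq> y" using that by (auto simp: contract_arc_def)
    then obtain u where "(u, v) \<in> parcs G" using ex_arc_into \<open>v \<noteq> s\<close> by blast
    moreover from this have "u \<noteq> v" using no_loop by auto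
    \<comment> \<open>An in-neighbour \<open>y\<close> turns into \<open>x\<close>; this gives no
      loop, since \<open>v = x\<close> would need the excluded arc \<open>(y, x)\<close>.\<close>
    ultimately have "((if u = y then x else u), v) \<in> parcs ?H"
      using v yx by (auto simp: contract_arc_def)
    then show ?thesis ..
  qed
qed

lemma single_source_dag_bypass_vertex:
  assumes "x \<in> pverts G" "x \<noteq> s"
  shows "single_source_dag (bypass_vertex G x) s"
proof (rule single_source_dag_replace)
  let ?H = "bypass_vertex G x"
  show "pverts ?H \<subseteq> pverts G" "parcs ?H \<subseteq> pverts ?H \<times> pverts ?H"
    using no_loop by (auto simp: bypass_vertex_def in_nbrs_def out_nbrs_def wellformed')
  show "parcs ?H \<subseteq> (parcs G)\<^sup>+"
    by (auto simp: bypass_vertex_def in_nbrs_def out_nbrs_def)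
  show "s \<in> pverts ?H"
    using assms source_in_verts by (auto simp: bypass_vertex_def)
  \<comment> \<open>As \<open>x\<close> is not the source, it has an in-neighbour \<open>w\<close>,
    which replaces \<open>x\<close> as in-neighbour of the vertices that \<open>x\<close> pointed
    to.\<close>
  obtain w where w: "(w, x) \<in> parcs G" using ex_arc_into assms by blast
  show "\<exists>u. (u, v) \<in> parcs ?H" if "v \<in> pverts ?H" "v \<noteq> s" for v
  proof -
    have v: "v \<in> pverts G" "v \<noteq> x" using that by (auto simp: bypass_vertex_def)
    then obtain u where "(u, v) \<in> parcs G" using ex_arc_into \<open>v \<noteq> s\<close> by blast
    then have "((if u = x then w else u), v) \<in> parcs ?H"
      using v w no_loop by (auto simp: bypass_vertex_def in_nbrs_def out_nbrs_def)
    then show ?thesis ..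
  qed
qed

lemma single_source_dag_step:
  assumes "reduction_step s G H"
  shows "single_source_dag H s"
  using assms
proof cases
  case (rule_A x y)
  then have "x \<in> in_nbrs G y" "card (in_nbrs G y) = 1"
    by (simp_all add: in_degree_eq_card_in_nbrs in_nbrs_def)
  then have "in_nbrs G y = {x}"
    by (metis card_1_singletonE singletonD)
  with rule_A show ?thesis by (simp add: single_source_dag_contract_arc)
next
  case (rule_B x y)
  then show ?thesis by (simp add: single_source_dag_bypass_vertex wellformed')
qed

text \<open>With a single in-neighbour \<open>u\<close> of \<open>v\<close>, Rule A or Rule B would
  apply to \<open>(u, v)\<close>, according to the out-degree of \<open>u\<close>. Rule B needs
  \<open>u\<close> to differ from \<open>s\<close>, hence the exception for out-neighbours of
  \<open>s\<close>.\<close>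

lemma irreducible_in_nbrs:
  assumes "\<not> (\<exists>H. reduction_step s G H)" "v \<in> pverts G" "v \<noteq> s" "(s, v) \<notin> parcs G"
  shows "2 \<le> card (in_nbrs G v)"
proof (rule ccontr)
  assume "\<not> 2 \<le> card (in_nbrs G v)"
  moreover obtain u where u: "(u, v) \<in> parcs G" using ex_arc_into assms(2,3) by blast
  then have "card (in_nbrs G v) \<noteq> 0" using finite_in_nbrs by (auto simp: in_nbrs_def)
  ultimately have deg: "in_degree G v = 1" by (simp add: in_degree_eq_card_in_nbrs)
  have "finite (out_nbrs G u)"
    by (rule finite_subset[OF _ pair_finite_verts]) (auto simp: out_nbrs_def wellformed')
  then have "out_degree G u \<noteq> 0"
    using u by (auto simp: out_degree_eq_card_out_nbrs out_nbrs_def)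
  then consider "out_degree G u = 1" | "2 \<le> out_degree G u" by linarith
  then show False
    using u deg assms(1,4) by cases (blast intro: reduction_step.intros)+
qed

end

section \<open>Out-branchings from parent functions\<close>

text \<open>A periodic sequence over the naturals gives each vertex of the cycle a successor without
  a special case at the wrap-around. Here \<open>q m\<close> is the head of the arc at index
  \<open>m mod length p\<close>.\<close>

lemma cycle_unrolled:
  assumes "pre_digraph.cycle (with_proj H) p"
  obtains q :: "nat \<Rightarrow> 'a"
  where "\<And>m. (q m, q (Suc m)) \<in> parcs H" "\<And>m. q (m + length p) = q m"
    "\<And>m m'. q m = q m' \<Longrightarrow> m mod length p = m' mod length p"
proof -
  obtain u where u: "set p \<subseteq> parcs H" "pcas u p u" "distinct (tl (pawalk_verts u p))" "p \<noteq> []"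
    using assms by (auto simp: pre_digraph.cycle_def pre_digraph.awalk_def
        cas_with_proj_eq awalk_verts_with_proj_eq)
  have verts: "pawalk_verts w p = w # map snd p" if "pcas w p w'" for w w' p
    using that by (induction p arbitrary: w) auto
  have dist: "distinct (map snd p)" using u(3) verts[OF u(2)] by simp
  have ends: "fst (hd p) = w" "snd (last p) = w'" if "pcas w p w'" "p \<noteq> []" for w w' p
    using that by (induction p arbitrary: w) (auto split: if_splits)
  have succ: "snd (p ! i) = fst (p ! Suc i)" if "pcas w p w'" "Suc i < length p" for w w' p i
    using that
  proof (induction p arbitrary: w i)
    case (Cons e p)
    then show ?case by (cases i; cases p) auto
  qed simp
  \<comment> \<open>Consecutive arcs meet, and the last one meets the first because the walk is
    closed.\<close>
  have step: "snd (p ! (m mod length p)) = fst (p ! (Suc m mod length p))" for m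
  proof (cases "Suc (m mod length p) < length p")
    case True
    then show ?thesis using succ[OF u(2)] by (simp add: mod_Suc)
  next
    case False
    then have "Suc (m mod length p) = length p"
      using u(4) by (simp add: Suc_leI le_antisym)
    then show ?thesis
      using ends[OF u(2,4)] u(4)
      by (metis One_nat_def diff_Suc_1 hd_conv_nth last_conv_nth mod_Suc)
  qed
  define q where "q = (\<lambda>m. snd (p ! (m mod length p)))"
  have "(q m, q (Suc m)) \<in> parcs H" for m
  proof -
    have "p ! (Suc m mod length p) \<in> parcs H" using u by (auto intro: nth_mem)
    then show ?thesis using step[of m] by (simp add: q_def)
  qed
  moreover have "q m = q m' \<Longrightarrow> m mod length p = m' mod length p" for m m'
    using dist u(4) nth_eq_iff_index_eq[OF dist, of "m mod length p" "m' mod length p"]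
    by (simp add: q_def)
  moreover have "q (m + length p) = q m" for m by (simp add: q_def)
  ultimately show ?thesis using that by blast
qed

context single_source_dag
begin

definition parent_graph :: "('a \<Rightarrow> 'a) \<Rightarrow> 'a pair_pre_digraph" where
  "parent_graph f = \<lparr>pverts = pverts G, parcs = {(f v, v) | v. v \<in> pverts G \<and> v \<noteq> s}\<rparr>"

context
  fixes f :: "'a \<Rightarrow> 'a"
  assumes parent_arc: "\<And>v. v \<in> pverts G \<Longrightarrow> v \<noteq> s \<Longrightarrow> (f v, v) \<in> parcs G"
begin

lemma parent_graph_arc_iff:
  "(u, v) \<in> parcs (parent_graph f) \<longleftrightarrow> v \<in> pverts G \<and> v \<noteq> s \<and> u = f v"
  by (auto simp: parent_graph_def)

lemma parent_graph_arcs_subset: "parcs (parent_graph f) \<subseteq> parcs G"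
  using parent_arc by (auto simp: parent_graph_def)

lemma parent_graph_wf: "pair_wf_digraph (parent_graph f)"
  using parent_graph_arcs_subset
  by unfold_locales (auto simp: parent_graph_def wellformed' dest: parent_arc)

lemma subgraph_parent_graph: "subgraph (parent_graph f) G"
  using parent_graph_arcs_subset parent_graph_wf wf_digraph_axioms
  by (auto simp: subgraph_def wf_digraph_wp_iff parent_graph_def)

text \<open>Well-founded induction along the arcs of the finite acyclic \<open>G\<close> shows that
  \<open>s\<close> reaches every vertex through parents; after symmetrising, any two vertices are
  joined via \<open>s\<close>.\<close>

lemma connected_parent_graph: "Digraph_Component.connected (parent_graph f)"
proof -
  interpret T: pair_wf_digraph "parent_graph f" by (rule parent_graph_wf)
  interpret S: pair_wf_digraph "mk_symmetric (parent_graph f)"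
    by (rule T.wellformed_mk_symmetric)
  have "wf (parcs G)"
    using pair_finite_arcs acyclic_arcs by (rule finite_acyclic_wf)
  then have reach: "v \<in> pverts G \<longrightarrow> s \<rightarrow>\<^sup>*\<^bsub>parent_graph f\<^esub> v" for v
  proof (induction v rule: wf_induct_rule)
    case (less v)
    show ?case
    proof (intro impI, cases "v = s")
      case True
      then show "s \<rightarrow>\<^sup>*\<^bsub>parent_graph f\<^esub> v"
        using source_in_verts T.reachable_refl[of s] by (simp add: parent_graph_def)
    next
      case False
      assume v: "v \<in> pverts G"
      have arc: "(f v, v) \<in> parcs G" using parent_arc v False by blast
      then have "s \<rightarrow>\<^sup>*\<^bsub>parent_graph f\<^esub> f v"
        using less.IH wellformed' by blast
      moreover have "(f v, v) \<in> parcs (parent_graph f)"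
        using v False by (simp add: parent_graph_arc_iff)
      ultimately show "s \<rightarrow>\<^sup>*\<^bsub>parent_graph f\<^esub> v"
        by (rule T.reachable_adj_trans)
    qed
  qed
  have sym: "s \<rightarrow>\<^sup>*\<^bsub>mk_symmetric (parent_graph f)\<^esub> v"
    "v \<rightarrow>\<^sup>*\<^bsub>mk_symmetric (parent_graph f)\<^esub> s" if "v \<in> pverts G" for v
  proof -
    show *: "s \<rightarrow>\<^sup>*\<^bsub>mk_symmetric (parent_graph f)\<^esub> v"
      using reach that by (blast intro: T.reachable_mk_symmetricI)
    show "v \<rightarrow>\<^sup>*\<^bsub>mk_symmetric (parent_graph f)\<^esub> s"
      using symmetric_mk_symmetric * by (rule symmetric_reachable)
  qed
  show ?thesis
    unfolding connected_def
  proof (rule strongly_connectedI)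
    show "verts (mk_symmetric (parent_graph f)) \<noteq> {}"
      using source_in_verts by (auto simp: parent_graph_def)
    show "u \<rightarrow>\<^sup>*\<^bsub>mk_symmetric (parent_graph f)\<^esub> v"
      if "u \<in> verts (mk_symmetric (parent_graph f))" "v \<in> verts (mk_symmetric (parent_graph f))"
      for u v
    proof (rule S.reachable_trans)
      show "u \<rightarrow>\<^sup>*\<^bsub>mk_symmetric (parent_graph f)\<^esub> s" "s \<rightarrow>\<^sup>*\<^bsub>mk_symmetric (parent_graph f)\<^esub> v"
        using that sym by (simp_all add: parent_graph_def)
    qed
  qed
qed

text \<open>
  A sink of the cycle would have both of its cycle neighbours as parents, so these coincide.
\<close>

lemma no_undirected_cycle_parent_graph:
  assumes "pre_digraph.cycle (mk_symmetric (parent_graph f)) p"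
  shows "length p < 3"
proof (rule ccontr)
  assume len: "\<not> length p < 3"
  obtain q where q: "\<And>m. (q m, q (Suc m)) \<in> parcs (mk_symmetric (parent_graph f))"
    "\<And>m. q (m + length p) = q m" "\<And>m m'. q m = q m' \<Longrightarrow> m mod length p = m' mod length p"
    using cycle_unrolled[OF assms] by blast
  have adj: "(q m, q (Suc m)) \<in> parcs (parent_graph f)
      \<or> (q (Suc m), q m) \<in> parcs (parent_graph f)" for m
    using q(1)[of m] by (auto simp: parcs_mk_symmetric)
  \<comment> \<open>A minimal element for the converse relation is a cycle vertex with no arc of
    \<open>G\<close> to any cycle vertex.\<close>
  have "wf ((parcs G)\<inverse>)"
    using pair_finite_arcs acyclic_arcs by (rule finite_acyclic_wf_converse)
  then obtain v where "v \<in> range q" "\<And>w. (w, v) \<in> (parcs G)\<inverse> \<Longrightarrow> w \<notin> range q"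
    by (rule wfE_min[of _ "q 0" "range q"]) auto
  then obtain m where sink: "\<And>m'. (q m, q m') \<notin> parcs G" by auto
  \<comment> \<open>The position before \<open>m\<close>, shifted by one period so that the
    subtraction is safe for \<open>m = 0\<close>.\<close>
  define l where "l = m + length p - 1"
  have "Suc l = m + length p" using len by (simp add: l_def)
  then have l: "q (Suc l) = q m" using q(2) by simp
  have "(q l, q m) \<in> parcs (parent_graph f)" "(q (Suc (Suc l)), q m) \<in> parcs (parent_graph f)"
    using adj[of l] adj[of "Suc l"] sink parent_graph_arcs_subset unfolding l by blast+
  \<comment> \<open>Both cycle neighbours of the sink equal \<open>f (q m)\<close>.\<close>
  then have "q (l + 2) = q l" by (simp add: parent_graph_arc_iff)
  then have "(l + 2) mod length p = l mod length p" by (rule q(3))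
  then have "length p dvd 2"
    by (metis add_diff_cancel_left' le_add1 mod_eq_dvd_iff_nat)
  then show False using len by (auto dest: dvd_imp_le)
qed

text \<open>Every vertex but \<open>s\<close> has its parent as only in-neighbour, so
  \<open>s\<close> is the unique root; opposite arcs are already impossible in
  \<open>G\<close>.\<close>

lemma out_branching_parent_graph: "out_branching (parent_graph f) G"
proof -
  have "asym (parcs (parent_graph f))"
    using parent_graph_arcs_subset no_opposite_arc by (blast intro: asymI)
  moreover have "in_nbrs (parent_graph f) v = (if v = s then {} else {f v})" if "v \<in> pverts G" for v
    using that by (auto simp: in_nbrs_def parent_graph_arc_iff)
  then have "in_degree (parent_graph f) v = 0 \<longleftrightarrow> v = s" if "v \<in> pverts G" for v
    using that by (simp add: in_degree_eq_card_in_nbrs)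
  then have "\<exists>!r. r \<in> pverts (parent_graph f) \<and> in_degree (parent_graph f) r = 0"
    using source_in_verts by (auto simp: parent_graph_def)
  ultimately show ?thesis
    using subgraph_parent_graph parent_graph_wf connected_parent_graph
      no_undirected_cycle_parent_graph
    by (auto simp: out_branching_def out_tree_def oriented_tree_def spanning_def not_le
        parent_graph_def)
qed

lemma leaves_parent_graph: "leaves (parent_graph f) = pverts G - f ` (pverts G - {s})"
proof -
  have "finite (out_nbrs (parent_graph f) v)" for v
    by (rule finite_subset[OF _ pair_finite_verts]) (auto simp: out_nbrs_def parent_graph_arc_iff)
  then show ?thesis
    by (auto simp: leaves_def out_degree_eq_card_out_nbrs out_nbrs_def parent_graph_arc_iff)
      (auto simp: parent_graph_def)
qed

end

section \<open>Many leaves in irreducible digraphs\<close>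

text \<open>All parents can be chosen outside \<open>I\<close>: for an out-neighbour of
  \<open>s\<close> take \<open>s\<close>, otherwise use the third assumption. No member of
  \<open>I\<close> is then a parent, so all are leaves.\<close>

lemma ex_out_branching_leaves_superset:
  assumes "s \<notin> I" "I \<subseteq> pverts G"
    and "\<And>v. v \<in> pverts G \<Longrightarrow> v \<noteq> s \<Longrightarrow> (s, v) \<notin> parcs G \<Longrightarrow> \<not> in_nbrs G v \<subseteq> I"
  shows "\<exists>T. out_branching T G \<and> card I \<le> card (leaves T)"
proof -
  have "\<forall>v. \<exists>u. v \<in> pverts G \<longrightarrow> v \<noteq> s \<longrightarrow> (u, v) \<in> parcs G \<and> u \<notin> I"
    using assms(1,3) by (fastforce simp: in_nbrs_def)
  then obtain f where f: "\<And>v. v \<in> pverts G \<Longrightarrow> v \<noteq> s \<Longrightarrow> (f v, v) \<in> parcs G \<and> f v \<notin> I"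
    by metis
  have "I \<subseteq> leaves (parent_graph f)"
    using assms(2) f by (auto simp: leaves_parent_graph)
  moreover have "finite (leaves (parent_graph f))"
    using f pair_finite_verts by (simp add: leaves_parent_graph)
  ultimately have "card I \<le> card (leaves (parent_graph f))"
    by (intro card_mono)
  then show ?thesis using out_branching_parent_graph f by blast
qed

lemma irreducible_ex_out_branching:
  assumes "\<not> (\<exists>H. reduction_step s G H)"
  shows "\<exists>T. out_branching T G \<and> card (pverts G) \<le> 3 * card (leaves T) + 1"
proof -
  let ?W = "pverts G - {s}" and ?J = "pverts G - {s} - out_nbrs G s"
  have "in_nbrs G v \<subseteq> ?W" "2 \<le> card (in_nbrs G v)" if "v \<in> ?J" for v
    using that irreducible_in_nbrs[OF assms, of v]
    by (auto simp: in_nbrs_def out_nbrs_def wellformed')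
  then obtain I where I: "I \<subseteq> ?W" "\<forall>v \<in> ?J. \<not> in_nbrs G v \<subseteq> I"
    "2 * card ?W \<le> 3 * card I + card ?J"
    using independent_set_card[of ?W ?J "in_nbrs G"] pair_finite_verts by auto
  \<comment> \<open>This turns the independent set bound into
    \<open>card ?W \<le> 3 * card I\<close>; the final \<open>+ 1\<close> accounts for
    \<open>s\<close>.\<close>
  have "card ?J \<le> card ?W" using pair_finite_verts by (intro card_mono) auto
  moreover have "card (pverts G) = Suc (card ?W)"
    using pair_finite_verts source_in_verts by (metis card.remove)
  moreover obtain T where "out_branching T G" "card I \<le> card (leaves T)"
    using ex_out_branching_leaves_superset[of I] I(1,2) by (auto simp: out_nbrs_def)
  ultimately show ?thesis using I(3) by (intro exI[of _ T]) auto
qed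

end

lemma single_source_dag_reduction:
  assumes "(reduction_step s)\<^sup>*\<^sup>* G H" "single_source_dag G s"
  shows "single_source_dag H s"
  using assms by (induction rule: rtranclp_induct) (auto intro: single_source_dag.single_source_dag_step)

theorem theorem5:
  fixes D Dstar :: "'a pair_pre_digraph" and s :: 'a and k :: nat
  assumes "pair_digraph D"
    and "acyclic (parcs D)"
    and "{v \<in> pverts D. in_degree (with_proj D) v = 0} = {s}"
    and "fully_reduces_to s D Dstar"
    and "0 < k"
    and "\<not> (\<exists>T. out_branching T Dstar \<and> k \<le> card (leaves T))"
  shows "real (card (pverts Dstar)) < 6.6 * (real k + 2)"
proof -
  interpret D: pair_digraph D by fact
  \<comment> \<open>Finiteness makes in-degree zero mean that there is no incoming arc.\<close>
  have "finite (in_arcs D v)" for v by (rule D.finite_in_arcs)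
  then have src: "v \<in> pverts D \<and> (\<forall>u. (u, v) \<notin> parcs D) \<longleftrightarrow> v = s" for v
    using assms(3) by (auto simp: in_degree_def in_arcs_def set_eq_iff)
  have "single_source_dag D s"
    by unfold_locales (use assms(2) src in blast)+
  then interpret Dstar: single_source_dag Dstar s
    using assms(4) single_source_dag_reduction by (auto simp: fully_reduces_to_def)
  obtain T where "out_branching T Dstar" "card (pverts Dstar) \<le> 3 * card (leaves T) + 1"
    using Dstar.irreducible_ex_out_branching assms(4) by (auto simp: fully_reduces_to_def)
  \<comment> \<open>Fewer than \<open>k\<close> leaves give even \<open>3 * (k - 1) + 1\<close>; the
    rounder \<open>3 * k\<close> already lies below the claimed bound.\<close>
  with assms(6) have "card (pverts Dstar) \<le> 3 * k" by force
  then show ?thesis by simp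
qed

end
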